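(* (Reduction to linear subdivision.) If all initial control normals are the same unit vector, $\mathbf{n}_i^0=\mathbf{n}_0$ for all $i\in\mathbb{Z}^s$, then the PN subdivision scheme reduces to the linear subdivision scheme: $\mathbf{p}_i^{k+1}=\sum_{j\in\mathbb{Z}^s}a_{i-2j}\mathbf{p}_j^k$ for all $i\in\mathbb{Z}^s$ and all $k\ge 0$.
   Context: PN (point-normal) subdivision. Let $s\in\{1,2\}$ and let $\{a_i:i\in\mathbb{Z}^s\}$ be a finitely supported real mask with $\sum_{j\in\mathbb{Z}^s}a_{i-2j}=1$ for all $i\in\mathbb{Z}^s$. Given points $\mathbf{p}_i^k$ and unit vectors $\mathbf{n}_i^k$, $i\in\mathbb{Z}^s$, the next level is $$\mathbf{q}_i^{k+1}=\sum_{j}a_{i-2j}\mathbf{p}_j^k,\qquad \mathbf{n}_i^{k+1}=\frac{\sum_j a_{i-2j}\mathbf{n}_j^k}{\left\|\sum_j a_{i-2j}\mathbf{n}_j^k\right\|},\qquad \mathbf{p}_i^{k+1}=\mathbf{q}_i^{k+1}+\sum_j a_{i-2j}h_{ij}^k\,\mathbf{n}_i^{k+1},$$ $$h_{ij}^k=\frac{(\mathbf{n}_j^k+\mathbf{n}_i^{k+1})^\top(\mathbf{p}_j^k-\mathbf{q}_i^{k+1})}{(\mathbf{n}_j^k+\mathbf{n}_i^{k+1})^\top\mathbf{n}_i^{k+1}}.$$ *)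

theory Defs
  imports "HOL-Analysis.Analysis" "HOL-Library.Groups_Big_Fun"
begin

(* The index lattice Z^s is the type int ^ 's with s = CARD('s). For a finitely supported mask
   all families under Sum_any are finitely supported, so each Sum_any is the genuine sum over Z^s. *)

definition subdivision_mask :: "(int ^ 's \<Rightarrow> real) \<Rightarrow> bool" where
  "subdivision_mask a \<longleftrightarrow>
     finite {i. a i \<noteq> 0} \<and> (\<forall>i. Sum_any (\<lambda>j. a (i - 2 *s j)) = 1)"

definition linear_step ::
    "(int ^ 's \<Rightarrow> real) \<Rightarrow> (int ^ 's \<Rightarrow> 'v) \<Rightarrow> int ^ 's \<Rightarrow> 'v::euclidean_space" where
  "linear_step a x i = Sum_any (\<lambda>j. a (i - 2 *s j) *\<^sub>R x j)"

(* Where the averaged normals cancel, or the denominator in pn_height vanishes, the scheme is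
   undefined; HOL's division by zero then yields 0. *)

definition normal_step ::
    "(int ^ 's \<Rightarrow> real) \<Rightarrow> (int ^ 's \<Rightarrow> 'v) \<Rightarrow> int ^ 's \<Rightarrow> 'v::euclidean_space" where
  "normal_step a n i = linear_step a n i /\<^sub>R norm (linear_step a n i)"

definition pn_height ::
    "(int ^ 's \<Rightarrow> real) \<Rightarrow> (int ^ 's \<Rightarrow> 'v::euclidean_space) \<Rightarrow> (int ^ 's \<Rightarrow> 'v) \<Rightarrow>
     int ^ 's \<Rightarrow> int ^ 's \<Rightarrow> real" where
  "pn_height a p n i j =
     ((n j + normal_step a n i) \<bullet> (p j - linear_step a p i)) /
     ((n j + normal_step a n i) \<bullet> normal_step a n i)"

definition point_step ::
    "(int ^ 's \<Rightarrow> real) \<Rightarrow> (int ^ 's \<Rightarrow> 'v) \<Rightarrow> (int ^ 's \<Rightarrow> 'v) \<Rightarrow>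
     int ^ 's \<Rightarrow> 'v::euclidean_space" where
  "point_step a p n i = linear_step a p i +
     Sum_any (\<lambda>j. (a (i - 2 *s j) * pn_height a p n i j) *\<^sub>R normal_step a n i)"

primrec pn_normals ::
    "(int ^ 's \<Rightarrow> real) \<Rightarrow> (int ^ 's \<Rightarrow> 'v) \<Rightarrow> nat \<Rightarrow> int ^ 's \<Rightarrow> 'v::euclidean_space" where
  "pn_normals a n\<^sub>0 0 = n\<^sub>0"
| "pn_normals a n\<^sub>0 (Suc k) = normal_step a (pn_normals a n\<^sub>0 k)"

primrec pn_points ::
    "(int ^ 's \<Rightarrow> real) \<Rightarrow> (int ^ 's \<Rightarrow> 'v) \<Rightarrow> (int ^ 's \<Rightarrow> 'v) \<Rightarrow> nat \<Rightarrow>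
     int ^ 's \<Rightarrow> 'v::euclidean_space" where
  "pn_points a p\<^sub>0 n\<^sub>0 0 = p\<^sub>0"
| "pn_points a p\<^sub>0 n\<^sub>0 (Suc k) = point_step a (pn_points a p\<^sub>0 n\<^sub>0 k) (pn_normals a n\<^sub>0 k)"

end

theory Submission
  imports Defs
begin

text \<open>Averaging with weights of total 1 reproduces constants, so a constant field of unit
  normals \<open>c\<close> survives every refinement (\<open>pn_normals_const\<close>). For such a
  field the height of \<open>p j\<close> is its signed distance, along \<open>c\<close>, from the
  hyperplane through the linear average \<open>q\<close> orthogonal to \<open>c\<close>
  (\<open>pn_height_const\<close>). Since \<open>q\<close> averages the points \<open>p j\<close>
  with the very weights that average the heights, these signed distances cancel
  (\<open>sum_mask_pn_height_const\<close>). The normal correction in \<open>point_step\<close> is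
  therefore zero, and only the linear step is left.\<close>

text \<open>The stencil is the preimage of the finite mask support under the injective map
  \<open>j \<mapsto> i - 2 *s j\<close>.\<close>

lemma finite_mask_stencil:
  fixes a :: "int ^ 's \<Rightarrow> real"
  assumes "subdivision_mask a"
  shows "finite {j. a (i - 2 *s j) \<noteq> 0}"
proof -
  have "inj (\<lambda>j :: int ^ 's. i - 2 *s j)"
    by (auto simp: inj_on_def vec_eq_iff)
  moreover have "finite {i. a i \<noteq> 0}"
    using assms by (simp add: subdivision_mask_def)
  ultimately have "finite ((\<lambda>j. i - 2 *s j) -` {i. a i \<noteq> 0})"
    by (rule finite_vimageI[rotated])
  then show ?thesis
    by (simp add: vimage_def)
qed

text \<open>All sums at index \<open>i\<close> are brought to one common finite index set, which may
  be larger than the support of \<open>f\<close>; there they can be split and combined by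
  linearity.\<close>

lemma Sum_any_stencil:
  fixes a :: "int ^ 's \<Rightarrow> real" and f :: "int ^ 's \<Rightarrow> 'b::comm_monoid_add"
  assumes "subdivision_mask a" and "\<And>j. a (i - 2 *s j) = 0 \<Longrightarrow> f j = 0"
  shows "Sum_any f = (\<Sum>j | a (i - 2 *s j) \<noteq> 0. f j)"
  using assms by (intro Sum_any.expand_superset finite_mask_stencil) auto

lemma sum_mask_stencil:
  fixes a :: "int ^ 's \<Rightarrow> real"
  assumes "subdivision_mask a"
  shows "(\<Sum>j | a (i - 2 *s j) \<noteq> 0. a (i - 2 *s j)) = 1"
  using assms Sum_any_stencil[OF assms, of i "\<lambda>j. a (i - 2 *s j)"]
  by (simp add: subdivision_mask_def)

lemma linear_step_eq_sum:
  fixes a :: "int ^ 's \<Rightarrow> real" and x :: "int ^ 's \<Rightarrow> 'v::euclidean_space"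
  assumes "subdivision_mask a"
  shows "linear_step a x i = (\<Sum>j | a (i - 2 *s j) \<noteq> 0. a (i - 2 *s j) *\<^sub>R x j)"
  unfolding linear_step_def by (rule Sum_any_stencil[OF assms]) simp

lemma linear_step_const:
  fixes a :: "int ^ 's \<Rightarrow> real" and c :: "'v::euclidean_space"
  assumes "subdivision_mask a"
  shows "linear_step a (\<lambda>_. c) i = c"
  by (simp add: linear_step_eq_sum[OF assms] sum_mask_stencil[OF assms]
      flip: scaleR_left.sum)

text \<open>The average is again \<open>c\<close>, and dividing by its norm 1 changes nothing.
  Equality as functions lets the step be iterated by rewriting.\<close>

lemma normal_step_const:
  fixes a :: "int ^ 's \<Rightarrow> real" and c :: "'v::euclidean_space"
  assumes "subdivision_mask a" and "norm c = 1"
  shows "normal_step a (\<lambda>_. c) = (\<lambda>_. c)"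
  using assms by (simp add: normal_step_def linear_step_const fun_eq_iff)

lemma pn_normals_const:
  fixes a :: "int ^ 's \<Rightarrow> real" and c :: "'v::euclidean_space"
  assumes "subdivision_mask a" and "norm c = 1"
  shows "pn_normals a (\<lambda>_. c) k = (\<lambda>_. c)"
  by (induction k) (simp_all add: normal_step_const assms)

text \<open>The denominator is \<open>(c + c) \<bullet> c = 2\<close>, so it does not vanish and
  cancels the factor 2 in the numerator.\<close>

lemma pn_height_const:
  fixes a :: "int ^ 's \<Rightarrow> real" and c :: "'v::euclidean_space"
  assumes "subdivision_mask a" and "norm c = 1"
  shows "pn_height a p (\<lambda>_. c) i j = c \<bullet> (p j - linear_step a p i)"
proof -
  have "c \<bullet> c = 1"
    using assms(2) by (simp add: dot_square_norm)
  then show ?thesis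
    by (simp add: pn_height_def normal_step_const[OF assms] inner_left_distrib)
qed

lemma sum_mask_pn_height_const:
  fixes a :: "int ^ 's \<Rightarrow> real" and c :: "'v::euclidean_space"
  assumes "subdivision_mask a" and "norm c = 1"
  shows "(\<Sum>j | a (i - 2 *s j) \<noteq> 0. a (i - 2 *s j) * pn_height a p (\<lambda>_. c) i j) = 0"
    (is "sum _ ?S = 0")
proof -
  let ?q = "linear_step a p i"
  have "(\<Sum>j\<in>?S. a (i - 2 *s j) * pn_height a p (\<lambda>_. c) i j) =
      (\<Sum>j\<in>?S. c \<bullet> (a (i - 2 *s j) *\<^sub>R p j) - a (i - 2 *s j) * (c \<bullet> ?q))"
    by (simp add: pn_height_const[OF assms] inner_diff_right algebra_simps)
  \<comment> \<open>Pulling \<open>c\<close> out of the first sum reassembles \<open>?q\<close>; the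
    second sum keeps only the total weight, which is 1.\<close>
  also have "\<dots> = c \<bullet> ?q - (\<Sum>j\<in>?S. a (i - 2 *s j)) * (c \<bullet> ?q)"
    by (simp only: sum_subtractf inner_sum_right[symmetric] sum_distrib_right[symmetric]
        linear_step_eq_sum[OF assms(1), symmetric])
  also have "\<dots> = 0"
    by (simp add: sum_mask_stencil[OF assms(1)])
  finally show ?thesis .
qed

lemma point_step_const_normal:
  fixes a :: "int ^ 's \<Rightarrow> real" and c :: "'v::euclidean_space"
  assumes "subdivision_mask a" and "norm c = 1"
  shows "point_step a p (\<lambda>_. c) i = linear_step a p i"
proof -
  have "Sum_any (\<lambda>j. (a (i - 2 *s j) * pn_height a p (\<lambda>_. c) i j) *\<^sub>R c) =
      (\<Sum>j | a (i - 2 *s j) \<noteq> 0. (a (i - 2 *s j) * pn_height a p (\<lambda>_. c) i j) *\<^sub>R c)"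
    by (rule Sum_any_stencil[OF assms(1)]) simp
  also have "\<dots> = 0"
    by (simp only: scaleR_left.sum[symmetric] sum_mask_pn_height_const[OF assms] scaleR_zero_left)
  finally show ?thesis
    by (simp add: point_step_def normal_step_const[OF assms])
qed

theorem mainTheorem3:
  fixes a :: "int ^ 's \<Rightarrow> real"
    and p_init n_init :: "int ^ 's \<Rightarrow> 'v::euclidean_space"
    and n0 :: 'v
  assumes "CARD('s) \<in> {1, 2}"
    and "subdivision_mask a"
    and "norm n0 = 1"
    and "\<forall>i. n_init i = n0"
  shows "\<forall>k i. pn_points a p_init n_init (Suc k) i =
           Sum_any (\<lambda>j. a (i - 2 *s j) *\<^sub>R pn_points a p_init n_init k j)"
proof -
  have "n_init = (\<lambda>_. n0)"
    using assms(4) by auto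
  then show ?thesis
    by (simp add: pn_normals_const point_step_const_normal assms(2,3) linear_step_def)
qed

end
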